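(* Let $1\le p<\infty$. The Hardy operator $C_0$ maps $H^p$ into $H^p$, and $C_0\colon H^p\to H^p$ is continuous with operator norm $\|C_0\|_{H^p\to H^p}=1$.
   Context: Let $\mathbb{D}=\{z\in\mathbb{C}:|z|<1\}$ and let $H(\mathbb{D})$ be the space of holomorphic functions on $\mathbb{D}$. For $1\le p<\infty$ the Hardy space $H^p$ is the Banach space of all $f\in H(\mathbb{D})$ with $\|f\|_p:=\sup_{0\le r<1}\left(\frac{1}{2\pi}\int_0^{2\pi}|f(re^{i\theta})|^p\,d\theta\right)^{1/p}<\infty$. The Hardy operator $C_0\colon H(\mathbb{D})\to H(\mathbb{D})$ is defined by $(C_0f)(0):=f(0)$ and $(C_0f)(z):=\frac1z\int_0^zf(\xi)\,d\xi$ for $z\in\mathbb{D}\setminus\{0\}$. *)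

theory Defs
  imports "HOL-Complex_Analysis.Complex_Analysis"
begin

(* A function on the unit disc is represented by its extension by zero to the whole plane, so that
   equality of functions on the disc is equality in the type and the norms below are definite. *)
definition holomorphic_disc :: "(complex \<Rightarrow> complex) set" where
  "holomorphic_disc = {f. f holomorphic_on ball 0 1 \<and> (\<forall>z. z \<notin> ball 0 1 \<longrightarrow> f z = 0)}"

definition hardy_norm :: "real \<Rightarrow> (complex \<Rightarrow> complex) \<Rightarrow> ereal" where
  "hardy_norm p f =
     (SUP r\<in>{0..<1::real}.
        ereal ((1 / (2 * pi) * integral {0..2 * pi} (\<lambda>\<theta>. norm (f (of_real r * cis \<theta>)) powr p)) powr (1 / p)))"

definition hardy_space :: "real \<Rightarrow> (complex \<Rightarrow> complex) set" where
  "hardy_space p = {f \<in> holomorphic_disc. hardy_norm p f < \<infinity>}"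

definition hardy_operator :: "(complex \<Rightarrow> complex) \<Rightarrow> complex \<Rightarrow> complex" where
  "hardy_operator f z =
     (if z \<notin> ball 0 1 then 0
      else if z = 0 then f 0
      else 1 / z * contour_integral (linepath 0 z) f)"

definition hardy_continuous :: "real \<Rightarrow> ((complex \<Rightarrow> complex) \<Rightarrow> complex \<Rightarrow> complex) \<Rightarrow> bool" where
  "hardy_continuous p T \<longleftrightarrow>
     (\<forall>f\<in>hardy_space p. \<forall>\<epsilon>::real. \<epsilon> > 0 \<longrightarrow> (\<exists>\<delta>::real. \<delta> > 0 \<and> (\<forall>g\<in>hardy_space p.
        hardy_norm p (\<lambda>z. g z - f z) < ereal \<delta> \<longrightarrow>
        hardy_norm p (\<lambda>z. T g z - T f z) < ereal \<epsilon>)))"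

(* Extended-real valued: an unbounded operator has norm \<infinity>, so an equation with a finite right-hand
   side also asserts boundedness. *)
definition hardy_opnorm :: "real \<Rightarrow> ((complex \<Rightarrow> complex) \<Rightarrow> complex \<Rightarrow> complex) \<Rightarrow> ereal" where
  "hardy_opnorm p T = (SUP f\<in>{f \<in> hardy_space p. hardy_norm p f \<le> 1}. hardy_norm p (T f))"

end

theory Submission
  imports Defs
begin

text \<open>
  The Hardy operator is an average over dilations: substituting \<open>\<xi> = t z\<close> gives
  \<open>C\<^sub>0 f z = \<integral>\<^sub>0\<^sup>1 f (t z) dt\<close> (lemma \<open>hardy_operator_eq_mean_dilations\<close>), and no dilation by a factor
  \<open>t \<le> 1\<close> increases the Hardy norm. To turn this into a norm estimate, Jensen's inequality for the
  convex function \<open>x \<mapsto> x\<^sup>p\<close> gives \<open>|C\<^sub>0 f z|\<^sup>p \<le> \<integral>\<^sub>0\<^sup>1 |f (t z)|\<^sup>p dt\<close>. Integrating over the circle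
  of radius \<open>r\<close> and exchanging the two integrals bounds the mean of \<open>|C\<^sub>0 f|\<^sup>p\<close> over that circle by an
  average over \<open>t\<close> of the means of \<open>|f|\<^sup>p\<close> over the circles of radius \<open>t r\<close>, each of which is at most
  \<open>\<parallel>f\<parallel>\<^sub>p\<^sup>p\<close>. Hence \<open>C\<^sub>0\<close> is a contraction (lemma \<open>hardy_norm_hardy_operator_le\<close>). The contraction
  estimate holds for every holomorphic function on the disc, with the value \<open>\<infinity>\<close> admitted; since
  \<open>C\<^sub>0\<close> is linear, continuity follows by applying it to differences. The bound 1 is attained
  because \<open>C\<^sub>0\<close> fixes the constant function 1, which has norm 1.

  That \<open>C\<^sub>0 f\<close> is holomorphic, also at the origin, holds because it is the difference quotient
  at 0 of a primitive of \<open>f\<close>, whose singularity at 0 is removable.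
\<close>

section \<open>Jensen's inequality for powers on the unit interval\<close>

text \<open>
  For positive \<open>x\<close> this is \<open>p\<close> times the weighted inequality between geometric and arithmetic
  mean, applied to \<open>x\<^sup>p\<close> and \<open>a\<^sup>p\<close> with weights \<open>1/p\<close> and \<open>1 - 1/p\<close>.
\<close>

lemma powr_above_tangent:
  fixes a x p :: real
  assumes p: "1 \<le> p" and a: "0 < a" and x: "0 \<le> x"
  shows "a powr p + p * a powr (p - 1) * (x - a) \<le> x powr p"
proof -
  have a_powr: "a powr p = a powr (p - 1) * a"
    using a by (simp add: powr_mult_base flip: powr_add mult.commute[of a])
  show ?thesis
  proof (cases "x = 0")
    case True
    have "a powr p * 1 \<le> a powr p * p"
      using p by (intro mult_left_mono) auto
    with True a_powr show ?thesis
      by (simp add: algebra_simps)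
  next
    case False
    then have "(x powr p) powr (1 / p) * (a powr p) powr (1 - 1 / p)
        \<le> 1 / p * x powr p + (1 - 1 / p) * a powr p"
      using p a x by (intro Youngs_inequality_0) auto
    moreover have "(x powr p) powr (1 / p) = x" "(a powr p) powr (1 - 1 / p) = a powr (p - 1)"
      using p x by (simp_all add: powr_powr right_diff_distrib)
    ultimately have "p * (x * a powr (p - 1)) \<le> p * (1 / p * x powr p + (1 - 1 / p) * a powr p)"
      using p by (intro mult_left_mono) auto
    also have "\<dots> = x powr p + (p - 1) * a powr p"
      using p by (simp add: field_simps)
    finally show ?thesis
      using a_powr by (simp add: algebra_simps)
  qed
qed

text \<open>Integrating the tangent inequality at the mean value makes its linear term vanish.\<close>

lemma powr_integral_le_integral_powr:
  fixes g :: "real \<Rightarrow> real"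
  assumes p: "1 \<le> p" and cont: "continuous_on {0..1} g"
    and nonneg: "\<And>t. t \<in> {0..1} \<Longrightarrow> 0 \<le> g t"
  shows "integral {0..1} g powr p \<le> integral {0..1} (\<lambda>t. g t powr p)"
proof -
  define a where "a = integral {0..1} g"
  have int: "g integrable_on {0..1}"
    by (intro integrable_continuous_real cont)
  have intp: "(\<lambda>t. g t powr p) integrable_on {0..1}"
    using p nonneg by (intro integrable_continuous_real continuous_on_powr' cont continuous_intros) auto
  have "0 \<le> a"
    unfolding a_def using int nonneg by (intro integral_nonneg) auto
  show ?thesis
  proof (cases "a = 0")
    case True
    then show ?thesis
      using intp by (auto simp: a_def intro!: integral_nonneg)
  next
    case False
    with \<open>0 \<le> a\<close> have "0 < a" by simp
    have tangent: "((\<lambda>t. a powr p + p * a powr (p - 1) * (g t - a)) has_integral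
        (a powr p + p * a powr (p - 1) * (a - a))) {0..1}"
      unfolding a_def
      by (intro has_integral_add has_integral_mult_right has_integral_diff integrable_integral int)
         (use has_integral_const_real[of _ 0 1] in auto)
    have "a powr p + p * a powr (p - 1) * (a - a) \<le> integral {0..1} (\<lambda>t. g t powr p)"
      using has_integral_le[OF tangent integrable_integral[OF intp]]
        powr_above_tangent[OF p \<open>0 < a\<close> nonneg] by auto
    then show ?thesis
      by (simp add: a_def)
  qed
qed

section \<open>The Hardy operator as an average of dilations\<close>

lemma scaled_in_unit_disc:
  fixes z :: complex
  assumes "z \<in> ball 0 1" "t \<in> {0..1::real}"
  shows "of_real t * z \<in> ball 0 1"
proof -
  have "t * norm z \<le> 1 * norm z"
    using assms by (intro mult_right_mono) auto
  with assms show ?thesis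
    by (simp add: norm_mult)
qed

lemma hardy_operator_eq_mean_dilations:
  assumes "z \<in> ball 0 1"
  shows "hardy_operator f z = integral {0..1} (\<lambda>t. f (of_real t * z))"
proof (cases "z = 0")
  case True
  then show ?thesis
    by (simp add: hardy_operator_def)
next
  case False
  have "contour_integral (linepath 0 z) f = integral {0..1} (\<lambda>t. f (of_real t * z) * z)"
    by (simp add: contour_integral_integral linepath_def scaleR_conv_of_real)
  also have "\<dots> = integral {0..1} (\<lambda>t. f (of_real t * z)) * z"
    by simp
  finally show ?thesis
    using assms False by (simp add: hardy_operator_def)
qed

lemma continuous_on_dilations:
  assumes "f holomorphic_on ball 0 1" "z \<in> ball 0 1"
  shows "continuous_on {0..1} (\<lambda>t. f (of_real t * z))"
proof (rule continuous_on_compose2[OF holomorphic_on_imp_continuous_on[OF assms(1)]])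
  show "(\<lambda>t. of_real t * z) ` {0..1} \<subseteq> ball 0 1"
    using scaled_in_unit_disc[OF assms(2)] by blast
qed (intro continuous_intros)

text \<open>
  On the disc \<open>C\<^sub>0 f\<close> is the difference quotient at 0 of a primitive of \<open>f\<close>, extended by the
  derivative \<open>f 0\<close>; such a quotient has a removable singularity.
\<close>

lemma hardy_operator_holomorphic_disc:
  assumes "f \<in> holomorphic_disc"
  shows "hardy_operator f \<in> holomorphic_disc"
proof -
  have hol: "f holomorphic_on ball 0 1"
    using assms by (simp add: holomorphic_disc_def)
  obtain F where "\<And>z. z \<in> ball 0 1 \<Longrightarrow> (F has_field_derivative f z) (at z within ball 0 1)"
    using holomorphic_convex_primitive'[OF convex_ball open_ball hol] by blast
  then have F: "(F has_field_derivative f z) (at z)" if "z \<in> ball 0 1" for z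
    using that by (metis at_within_open open_ball)
  have "F holomorphic_on ball 0 1"
    unfolding holomorphic_on_open[OF open_ball] using F by blast
  then have "(\<lambda>z. if z = 0 then deriv F 0 else (F z - F 0) / (z - 0)) holomorphic_on ball 0 1"
    by (rule pole_lemma_open) simp
  moreover have "(if z = 0 then deriv F 0 else (F z - F 0) / (z - 0)) = hardy_operator f z"
    if z: "z \<in> ball 0 1" for z
  proof (cases "z = 0")
    case True
    then show ?thesis
      using F[of 0] by (simp add: hardy_operator_def DERIV_imp_deriv)
  next
    case False
    have segment: "closed_segment 0 z \<subseteq> ball 0 1"
      using z by (intro closed_segment_subset) auto
    have "(f has_contour_integral (F (pathfinish (linepath 0 z)) - F (pathstart (linepath 0 z))))
        (linepath 0 z)"
    proof (rule contour_integral_primitive[where S = "ball 0 1"])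
      show "(F has_field_derivative f w) (at w within ball 0 1)" if "w \<in> ball 0 1" for w
        using F[OF that] by (rule has_field_derivative_at_within)
    qed (simp_all only: valid_path_linepath path_image_linepath segment)
    then have "contour_integral (linepath 0 z) f = F z - F 0"
      by (simp add: contour_integral_unique)
    with z False show ?thesis
      by (simp add: hardy_operator_def)
  qed
  ultimately have "hardy_operator f holomorphic_on ball 0 1"
    by (rule holomorphic_transform)
  then show ?thesis
    by (auto simp: holomorphic_disc_def hardy_operator_def)
qed

lemma hardy_operator_diff:
  assumes "f \<in> holomorphic_disc" "g \<in> holomorphic_disc"
  shows "(\<lambda>z. hardy_operator g z - hardy_operator f z) = hardy_operator (\<lambda>z. g z - f z)"
proof
  fix z
  show "hardy_operator g z - hardy_operator f z = hardy_operator (\<lambda>z. g z - f z) z"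
  proof (cases "z \<in> ball 0 1")
    case True
    have "(\<lambda>t. f (of_real t * z)) integrable_on {0..1}" "(\<lambda>t. g (of_real t * z)) integrable_on {0..1}"
      using assms True
      by (auto simp: holomorphic_disc_def intro!: integrable_continuous_real continuous_on_dilations)
    then show ?thesis
      by (simp add: hardy_operator_eq_mean_dilations[OF True] integral_diff)
  qed (auto simp: hardy_operator_def)
qed

section \<open>The contraction estimate\<close>

lemma cis_circle_in_unit_disc:
  assumes "r \<in> {0..<1::real}"
  shows "of_real r * cis \<theta> \<in> ball 0 1"
  using assms by (simp add: norm_mult)

lemma continuous_on_circle_powr:
  assumes "f holomorphic_on ball 0 1" "r \<in> {0..<1::real}" "0 < p"
  shows "continuous_on S (\<lambda>\<theta>. norm (f (of_real r * cis \<theta>)) powr p)"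
  using assms cis_circle_in_unit_disc[OF assms(2)]
  by (intro continuous_on_powr' continuous_intros
        continuous_on_compose2[OF holomorphic_on_imp_continuous_on[OF assms(1)]]) auto

text \<open>Jensen's inequality at each point of the circle, followed by Fubini's theorem.\<close>

lemma hardy_operator_circle_integral_le:
  assumes p: "1 \<le> p" and f: "f \<in> holomorphic_disc" and r: "r \<in> {0..<1::real}"
  shows "integral {0..2 * pi} (\<lambda>\<theta>. norm (hardy_operator f (of_real r * cis \<theta>)) powr p)
    \<le> integral {0..1} (\<lambda>t. integral {0..2 * pi} (\<lambda>\<theta>. norm (f (of_real (t * r) * cis \<theta>)) powr p))"
proof -
  have hol: "f holomorphic_on ball 0 1"
    using f by (simp add: holomorphic_disc_def)
  let ?h = "\<lambda>\<theta> t. norm (f (of_real (t * r) * cis \<theta>)) powr p"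
  have scaled: "of_real (t * r) * cis \<theta> \<in> ball 0 1" if "t \<in> {0..1}" for t \<theta>
    using scaled_in_unit_disc[OF cis_circle_in_unit_disc[OF r] that] by (simp add: mult.assoc)
  have "continuous_on (cbox (0, 0) (2 * pi, 1)) (\<lambda>(\<theta>, t). f (of_real (t * r) * cis \<theta>))"
    unfolding case_prod_beta
  proof (rule continuous_on_compose2[OF holomorphic_on_imp_continuous_on[OF hol]])
    show "(\<lambda>x. of_real (snd x * r) * cis (fst x)) ` cbox (0, 0) (2 * pi, 1) \<subseteq> ball 0 1"
      using scaled by (fastforce simp: cbox_Pair_eq)
  qed (intro continuous_intros)
  then have cont: "continuous_on (cbox (0, 0) (2 * pi, 1)) (\<lambda>(\<theta>, t). ?h \<theta> t)"
    using p unfolding case_prod_beta by (intro continuous_on_powr' continuous_intros) auto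
  have pointwise: "norm (hardy_operator f (of_real r * cis \<theta>)) powr p \<le> integral {0..1} (?h \<theta>)" for \<theta>
  proof -
    have z: "of_real r * cis \<theta> \<in> ball 0 1"
      by (rule cis_circle_in_unit_disc[OF r])
    have dil: "continuous_on {0..1} (\<lambda>t. f (of_real (t * r) * cis \<theta>))"
      using continuous_on_dilations[OF hol z] by (simp add: mult.assoc)
    have "norm (hardy_operator f (of_real r * cis \<theta>))
        \<le> integral {0..1} (\<lambda>t. norm (f (of_real (t * r) * cis \<theta>)))"
      using hardy_operator_eq_mean_dilations[OF z, of f] dil
      by (auto simp: mult.assoc intro!: integral_norm_bound_integral integrable_continuous_real
          continuous_intros)
    then have "norm (hardy_operator f (of_real r * cis \<theta>)) powr p
        \<le> integral {0..1} (\<lambda>t. norm (f (of_real (t * r) * cis \<theta>))) powr p"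
      using p by (intro powr_mono2) auto
    also have "\<dots> \<le> integral {0..1} (?h \<theta>)"
      using p dil by (intro powr_integral_le_integral_powr continuous_intros) auto
    finally show ?thesis .
  qed
  have "continuous_on {0..2 * pi} (\<lambda>\<theta>. integral (cbox 0 1) (?h \<theta>))"
    using cont by (intro integral_continuous_on_param) (simp add: cbox_Pair_eq)
  moreover have "hardy_operator f holomorphic_on ball 0 1"
    using hardy_operator_holomorphic_disc[OF f] by (simp add: holomorphic_disc_def)
  ultimately have "integral {0..2 * pi} (\<lambda>\<theta>. norm (hardy_operator f (of_real r * cis \<theta>)) powr p)
      \<le> integral {0..2 * pi} (\<lambda>\<theta>. integral {0..1} (?h \<theta>))"
    using p r pointwise
    by (intro integral_le integrable_continuous_real continuous_on_circle_powr) auto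
  also have "\<dots> = integral {0..1} (\<lambda>t. integral {0..2 * pi} (\<lambda>\<theta>. ?h \<theta> t))"
    using integral_swap_continuous[OF cont] by simp
  finally show ?thesis .
qed

lemma hardy_norm_ge_mean:
  assumes "r \<in> {0..<1::real}"
  shows "ereal ((1 / (2 * pi) * integral {0..2 * pi} (\<lambda>\<theta>. norm (f (of_real r * cis \<theta>)) powr p)) powr (1 / p))
    \<le> hardy_norm p f"
  unfolding hardy_norm_def using assms by (rule SUP_upper)

lemma circle_integral_le_of_hardy_norm_le:
  assumes p: "0 < p" and f: "f holomorphic_on ball 0 1" and N: "hardy_norm p f \<le> ereal N"
    and r: "r \<in> {0..<1::real}"
  shows "integral {0..2 * pi} (\<lambda>\<theta>. norm (f (of_real r * cis \<theta>)) powr p) \<le> 2 * pi * N powr p"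
proof -
  define m where "m = 1 / (2 * pi) * integral {0..2 * pi} (\<lambda>\<theta>. norm (f (of_real r * cis \<theta>)) powr p)"
  have "0 \<le> m"
    unfolding m_def using p f r
    by (intro mult_nonneg_nonneg integral_nonneg integrable_continuous_real continuous_on_circle_powr) auto
  have "m powr (1 / p) \<le> N"
    using order_trans[OF hardy_norm_ge_mean[OF r] N] by (simp add: m_def)
  then have "(m powr (1 / p)) powr p \<le> N powr p"
    using p by (intro powr_mono2) auto
  with p \<open>0 \<le> m\<close> have "m \<le> N powr p"
    by (simp add: powr_powr)
  then show ?thesis
    by (simp add: m_def field_simps)
qed

lemma hardy_norm_nonneg: "0 \<le> hardy_norm p f"
proof -
  have "0 \<le> ereal ((1 / (2 * pi) * integral {0..2 * pi} (\<lambda>\<theta>. norm (f (of_real 0 * cis \<theta>)) powr p)) powr (1 / p))"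
    by simp
  also have "\<dots> \<le> hardy_norm p f"
    by (rule hardy_norm_ge_mean) simp
  finally show ?thesis .
qed

text \<open>
  Each of the circles of radius \<open>t r\<close> that enter the average over \<open>t\<close> lies inside the disc, so the
  inner integral is bounded by \<open>2 \<pi> \<parallel>f\<parallel>\<^sub>p\<^sup>p\<close> uniformly in \<open>t\<close>.
\<close>

lemma hardy_norm_hardy_operator_le:
  assumes p: "1 \<le> p" and f: "f \<in> holomorphic_disc"
  shows "hardy_norm p (hardy_operator f) \<le> hardy_norm p f"
proof (cases "hardy_norm p f")
  case (real N)
  then have "0 \<le> N"
    using hardy_norm_nonneg[of p f] by simp
  have hol: "f holomorphic_on ball 0 1"
    using f by (simp add: holomorphic_disc_def)
  have "ereal ((1 / (2 * pi) * integral {0..2 * pi}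
      (\<lambda>\<theta>. norm (hardy_operator f (of_real r * cis \<theta>)) powr p)) powr (1 / p)) \<le> ereal N"
    if r: "r \<in> {0..<1::real}" for r
  proof -
    define I where "I = integral {0..2 * pi} (\<lambda>\<theta>. norm (hardy_operator f (of_real r * cis \<theta>)) powr p)"
    have "hardy_operator f holomorphic_on ball 0 1"
      using hardy_operator_holomorphic_disc[OF f] by (simp add: holomorphic_disc_def)
    then have "0 \<le> I"
      unfolding I_def using p r
      by (intro integral_nonneg integrable_continuous_real continuous_on_circle_powr) auto
    let ?J = "\<lambda>t. integral {0..2 * pi} (\<lambda>\<theta>. norm (f (of_real (t * r) * cis \<theta>)) powr p)"
    have tr: "t * r \<in> {0..<1}" if "t \<in> {0..1}" for t
      using that r mult_right_mono[of t 1 r] by auto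
    have "I \<le> integral {0..1} ?J"
      unfolding I_def by (rule hardy_operator_circle_integral_le[OF p f r])
    also have "\<dots> \<le> 2 * pi * N powr p"
    proof (cases "?J integrable_on {0..1}")
      case True
      then have "integral {0..1} ?J \<le> integral {0..1::real} (\<lambda>_. 2 * pi * N powr p)"
        using p real tr
        by (intro integral_le circle_integral_le_of_hardy_norm_le[OF _ hol]) auto
      then show ?thesis by simp
    next
      \<comment> \<open>The integral of a non-integrable function is 0, below the bound, which is nonnegative.\<close>
      case False
      then show ?thesis by (simp add: not_integrable_integral)
    qed
    finally have "1 / (2 * pi) * I \<le> N powr p"
      by (simp add: field_simps)
    then have "(1 / (2 * pi) * I) powr (1 / p) \<le> (N powr p) powr (1 / p)"
      using p \<open>0 \<le> I\<close> by (intro powr_mono2) auto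
    also have "\<dots> = N"
      using p \<open>0 \<le> N\<close> by (simp add: powr_powr)
    finally show ?thesis
      by (simp add: I_def)
  qed
  then show ?thesis
    unfolding real by (subst hardy_norm_def) (rule SUP_least)
qed (use hardy_norm_nonneg[of p f] in auto)

section \<open>The constant function\<close>

lemma indicator_disc_holomorphic_disc:
  "(\<lambda>z. if z \<in> ball 0 1 then 1 else 0) \<in> holomorphic_disc"
proof -
  have "(\<lambda>z. 1 :: complex) holomorphic_on ball 0 1"
    by (intro holomorphic_intros)
  then have "(\<lambda>z. if z \<in> ball 0 1 then 1 else 0 :: complex) holomorphic_on ball 0 1"
    by (rule holomorphic_transform) simp
  then show ?thesis
    by (simp add: holomorphic_disc_def)
qed

lemma hardy_norm_indicator_disc: "hardy_norm p (\<lambda>z. if z \<in> ball 0 1 then 1 else 0) = 1"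
  unfolding hardy_norm_def by (rule SUP_eq_const) (auto simp: norm_mult)

lemma hardy_operator_indicator_disc:
  "hardy_operator (\<lambda>z. if z \<in> ball 0 1 then 1 else 0) = (\<lambda>z. if z \<in> ball 0 1 then 1 else 0)"
proof
  fix z :: complex
  let ?u = "\<lambda>z::complex. if z \<in> ball 0 1 then 1 else 0 :: complex"
  show "hardy_operator ?u z = ?u z"
  proof (cases "z \<in> ball 0 1")
    case True
    have "integral {0..1} (\<lambda>t. ?u (of_real t * z)) = integral {0..1::real} (\<lambda>_. 1)"
      by (intro integral_cong) (use scaled_in_unit_disc[OF True] in auto)
    with True show ?thesis
      by (simp add: hardy_operator_eq_mean_dilations)
  qed (auto simp: hardy_operator_def)
qed

section \<open>The Hardy operator on Hardy spaces\<close>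

theorem proposition3p2:
  fixes p :: real
  assumes "1 \<le> p"
  shows "hardy_operator ` hardy_space p \<subseteq> hardy_space p
    \<and> hardy_continuous p hardy_operator
    \<and> hardy_opnorm p hardy_operator = 1"
proof (intro conjI)
  show "hardy_operator ` hardy_space p \<subseteq> hardy_space p"
    unfolding hardy_space_def
    using hardy_operator_holomorphic_disc le_less_trans[OF hardy_norm_hardy_operator_le[OF assms]]
    by blast
next
  have "hardy_norm p (\<lambda>z. hardy_operator g z - hardy_operator f z) \<le> hardy_norm p (\<lambda>z. g z - f z)"
    if "f \<in> hardy_space p" "g \<in> hardy_space p" for f g
  proof -
    have "f \<in> holomorphic_disc" "g \<in> holomorphic_disc"
      using that by (auto simp: hardy_space_def)
    moreover from this have "(\<lambda>z. g z - f z) \<in> holomorphic_disc"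
      by (auto simp: holomorphic_disc_def intro: holomorphic_on_diff)
    ultimately show ?thesis
      by (simp add: hardy_operator_diff hardy_norm_hardy_operator_le[OF assms])
  qed
  then show "hardy_continuous p hardy_operator"
    unfolding hardy_continuous_def by (blast intro: le_less_trans)
next
  let ?u = "\<lambda>z::complex. if z \<in> ball 0 1 then 1 else 0 :: complex"
  show "hardy_opnorm p hardy_operator = 1"
  proof (rule antisym)
    show "hardy_opnorm p hardy_operator \<le> 1"
      unfolding hardy_opnorm_def
      using hardy_norm_hardy_operator_le[OF assms]
      by (intro SUP_least) (auto simp: hardy_space_def intro: order_trans)
    have "?u \<in> {f \<in> hardy_space p. hardy_norm p f \<le> 1}"
      by (simp only: mem_Collect_eq hardy_space_def hardy_norm_indicator_disc
          indicator_disc_holomorphic_disc) simp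
    then have "hardy_norm p (hardy_operator ?u) \<le> hardy_opnorm p hardy_operator"
      unfolding hardy_opnorm_def by (rule SUP_upper)
    then show "1 \<le> hardy_opnorm p hardy_operator"
      by (simp only: hardy_operator_indicator_disc hardy_norm_indicator_disc)
  qed
qed

end
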